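(* Consider the descriptor system $$\dot x_1(t)=A_{11}x_1(t)+A_{12}x_2(t)+B_1u(t),\quad 0=A_{21}x_1(t)+A_{22}x_2(t)+B_2u(t),\quad y(t)=C_1x_1(t)+C_2x_2(t)+Du(t)$$ with unknown input $u(t)$, and the associated nonsingular system with state $\tilde x_1$ and unknown inputs $\tilde x_2,\tilde u$, $$\dot{\tilde x}_1(t)=A_{11}\tilde x_1(t)+B_1\tilde u(t)+A_{12}\tilde x_2(t),\qquad \tilde y(t)=\begin{bmatrix}A_{21}\\ C_1\end{bmatrix}\tilde x_1(t)+\begin{bmatrix}A_{22}&B_2\\ C_2&D\end{bmatrix}\begin{bmatrix}\tilde x_2(t)\\ \tilde u(t)\end{bmatrix}.$$ Let $\mathcal V_1^*$ be the largest controlled invariant subspace of the associated nonsingular system contained in the null space of the output matrix. Then the state $x_1(t)$ of the descriptor system can be reconstructed only modulo $\mathcal V_1^*$ through the measurements $y(t)$.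
   Context: Real matrices of compatible dimensions; the descriptor system is a partitioned form of $E\dot x=Ax+Bu$, $y=Cx+Du$. Standing assumptions of the paper on the descriptor system: regular pair $(E,A)$ (i.e. $\det(sE-A)\not\equiv0$), consistent initial conditions, smooth inputs. $\mathcal V_1^*$ (largest controlled invariant, or output-nulling, or weakly unobservable, subspace) is the largest subspace $\mathcal V$ of the $\tilde x_1$-space such that $$\begin{bmatrix}A_{11}\\ A_{21}\\ C_1\end{bmatrix}\mathcal V\subseteq(\mathcal V\times\{0\}\times\{0\})+\mathrm{Im}\begin{bmatrix}A_{12}&B_1\\ A_{22}&B_2\\ C_2&D\end{bmatrix};$$ equivalently, the set of $\tilde x_1(0)$ for which there are inputs $\tilde x_2,\tilde u$ making $\tilde y$ identically zero. "Can be reconstructed only modulo $\mathcal V$ through $y$" means that the class of the state modulo $\mathcal V$ is determined by the measurement signal $y$ (without knowledge of $u$), i.e. two solutions with the same output have states differing by an element of $\mathcal V$, and that the component of the state in $\mathcal V$ cannot be reconstructed, i.e. $\mathcal V$ is the smallest such subspace. *)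

theory Defs
  imports "HOL-Analysis.Analysis" "HOL-Library.Set_Algebras"
begin

text \<open>
  The state-space system is x' = A x + B w, z = C x + D w, given by its four linear maps;
  the sum on the right of the inclusion is the sum of sets from \<^theory>\<open>HOL-Library.Set_Algebras\<close>.
\<close>

definition output_nulling ::
  "('x::real_vector \<Rightarrow> 'x) \<Rightarrow> ('w \<Rightarrow> 'x) \<Rightarrow> ('x \<Rightarrow> 'z::real_vector) \<Rightarrow> ('w \<Rightarrow> 'z) \<Rightarrow> 'x set \<Rightarrow> bool"
  where "output_nulling A B C D V \<longleftrightarrow>
    subspace V \<and> (\<lambda>x. (A x, C x)) ` V \<subseteq> V \<times> {0} + range (\<lambda>w. (B w, D w))"

definition largest_output_nulling ::
  "('x::real_vector \<Rightarrow> 'x) \<Rightarrow> ('w \<Rightarrow> 'x) \<Rightarrow> ('x \<Rightarrow> 'z::real_vector) \<Rightarrow> ('w \<Rightarrow> 'z) \<Rightarrow> 'x set"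
  where "largest_output_nulling A B C D = (GREATEST V. output_nulling A B C D V)"

lemma output_nulling_iff:
  "output_nulling A B C D V \<longleftrightarrow>
    subspace V \<and> (\<forall>x\<in>V. \<exists>v\<in>V. \<exists>w. A x = v + B w \<and> C x = D w)"
proof -
  have "(A x, C x) \<in> V \<times> {0} + range (\<lambda>w. (B w, D w)) \<longleftrightarrow>
      (\<exists>v\<in>V. \<exists>w. A x = v + B w \<and> C x = D w)" for x
    by (auto simp: set_plus_def)
  then show ?thesis
    unfolding output_nulling_def image_subset_iff by blast
qed

lemma output_nulling_span_Union:
  fixes B :: "'w::real_vector \<Rightarrow> 'x::real_vector"
  assumes lin: "linear A" "linear B" "linear C" "linear D"
  shows "output_nulling A B C D (span (\<Union>{V. output_nulling A B C D V}))"
proof -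
  let ?S = "span (\<Union>{V. output_nulling A B C D V})"
  have "\<exists>v\<in>?S. \<exists>w. A x = v + B w \<and> C x = D w" if "x \<in> ?S" for x
    using that
  proof (induction rule: span_induct_alt)
    case base
    show ?case
      using lin by (intro bexI[of _ 0] exI[of _ 0]) (auto simp: linear_0 span_zero)
  next
    case (step c x y)
    from step(1) obtain V where V: "output_nulling A B C D V" "x \<in> V" by blast
    then obtain v w where 1: "v \<in> V" "A x = v + B w" "C x = D w"
      unfolding output_nulling_iff by blast
    have "v \<in> ?S" using V(1) 1(1) by (auto intro: span_base)
    from step(2) obtain v' w' where 2: "v' \<in> ?S" "A y = v' + B w'" "C y = D w'" by blast
    show ?case
    proof (intro bexI exI conjI)
      show "c *\<^sub>R v + v' \<in> ?S" using \<open>v \<in> ?S\<close> 2(1) by (intro span_add span_scale)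
      show "A (c *\<^sub>R x + y) = (c *\<^sub>R v + v') + B (c *\<^sub>R w + w')"
        using lin 1 2 by (simp add: linear_add linear_scale algebra_simps)
      show "C (c *\<^sub>R x + y) = D (c *\<^sub>R w + w')"
        using lin 1 2 by (simp add: linear_add linear_scale)
    qed
  qed
  then show ?thesis unfolding output_nulling_iff by simp
qed

text \<open>For linear maps the largest such subspace exists, so GREATEST is well defined.\<close>

lemma largest_output_nulling:
  fixes B :: "'w::real_vector \<Rightarrow> 'x::real_vector"
  assumes "linear A" "linear B" "linear C" "linear D"
  shows output_nulling_largest: "output_nulling A B C D (largest_output_nulling A B C D)"
    and output_nulling_le_largest:
      "\<And>V. output_nulling A B C D V \<Longrightarrow> V \<subseteq> largest_output_nulling A B C D"
proof -
  let ?S = "span (\<Union>{V. output_nulling A B C D V})"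
  have S: "output_nulling A B C D ?S" by (rule output_nulling_span_Union[OF assms])
  have le: "V \<subseteq> ?S" if "output_nulling A B C D V" for V
    using that by (auto intro: span_base)
  have "largest_output_nulling A B C D = ?S"
    unfolding largest_output_nulling_def
    using S le by (rule Greatest_equality)
  with S le show "output_nulling A B C D (largest_output_nulling A B C D)"
    and "\<And>V. output_nulling A B C D V \<Longrightarrow> V \<subseteq> largest_output_nulling A B C D" by auto
qed

definition block_matrix ::
  "real^'n^'n \<Rightarrow> real^'k^'n \<Rightarrow> real^'n^'k \<Rightarrow> real^'k^'k \<Rightarrow> real^('n::finite + 'k::finite)^('n + 'k)"
  where "block_matrix P Q R S = (\<chi> i j. case i of
      Inl a \<Rightarrow> (case j of Inl b \<Rightarrow> P $ a $ b | Inr b \<Rightarrow> Q $ a $ b)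
    | Inr a \<Rightarrow> (case j of Inl b \<Rightarrow> R $ a $ b | Inr b \<Rightarrow> S $ a $ b))"

definition regular_pair :: "real^'n^'n \<Rightarrow> real^'n^'n \<Rightarrow> bool"
  where "regular_pair E A \<longleftrightarrow> \<not> (\<forall>s. det (s *\<^sub>R E - A) = 0)"

text \<open>Infinitely differentiable on [0,oo), one-sided at 0; g k is the k-th derivative.\<close>

definition smooth_signal :: "(real \<Rightarrow> 'v::real_normed_vector) \<Rightarrow> bool"
  where "smooth_signal f \<longleftrightarrow> (\<exists>g. g 0 = f \<and>
    (\<forall>k. \<forall>t\<ge>0. (g k has_vector_derivative g (Suc k) t) (at t within {0..})))"

text \<open>
  Trajectories (x1, x2, u, y) on [0,oo). Initial conditions are consistent because only those
  from which a trajectory starts occur. No smoothness of x2 is asked for: if the pair (E, A) is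
  regular, smoothness of u already forces x1 and x2 to be smooth.
\<close>

definition descriptor_solution ::
  "real^'n^'n \<Rightarrow> real^'k^'n \<Rightarrow> real^'n^'k \<Rightarrow> real^'k^'k \<Rightarrow> real^'m^'n \<Rightarrow> real^'m^'k \<Rightarrow>
   real^'n^'p \<Rightarrow> real^'k^'p \<Rightarrow> real^'m^'p \<Rightarrow>
   (real \<Rightarrow> real^'n) \<Rightarrow> (real \<Rightarrow> real^'k) \<Rightarrow> (real \<Rightarrow> real^'m) \<Rightarrow> (real \<Rightarrow> real^'p) \<Rightarrow> bool"
  where "descriptor_solution A11 A12 A21 A22 B1 B2 C1 C2 D x1 x2 u y \<longleftrightarrow>
    smooth_signal u \<and>
    (\<forall>t\<ge>0.
      (x1 has_vector_derivative (A11 *v x1 t + A12 *v x2 t + B1 *v u t)) (at t within {0..}) \<and>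
      0 = A21 *v x1 t + A22 *v x2 t + B2 *v u t \<and>
      y t = C1 *v x1 t + C2 *v x2 t + D *v u t)"

text \<open>
  The associated nonsingular system has state x1, input (x2, u) and output
  (A21 x1 + A22 x2 + B2 u, C1 x1 + C2 x2 + D u).
\<close>

definition V1_star ::
  "real^'n^'n \<Rightarrow> real^'k^'n \<Rightarrow> real^'n^'k \<Rightarrow> real^'k^'k \<Rightarrow> real^'m^'n \<Rightarrow> real^'m^'k \<Rightarrow>
   real^'n^'p \<Rightarrow> real^'k^'p \<Rightarrow> real^'m^'p \<Rightarrow> (real^'n) set"
  where "V1_star A11 A12 A21 A22 B1 B2 C1 C2 D =
    largest_output_nulling
      (\<lambda>x1. A11 *v x1)
      (\<lambda>(x2, u). A12 *v x2 + B1 *v u)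
      (\<lambda>x1. (A21 *v x1, C1 *v x1))
      (\<lambda>(x2, u). (A22 *v x2 + B2 *v u, C2 *v x2 + D *v u))"

text \<open>The two trajectories compared may have different inputs: u is unknown.\<close>

definition reconstructible_modulo ::
  "real^'n^'n \<Rightarrow> real^'k^'n \<Rightarrow> real^'n^'k \<Rightarrow> real^'k^'k \<Rightarrow> real^'m^'n \<Rightarrow> real^'m^'k \<Rightarrow>
   real^'n^'p \<Rightarrow> real^'k^'p \<Rightarrow> real^'m^'p \<Rightarrow> real \<Rightarrow> (real^'n) set \<Rightarrow> bool"
  where "reconstructible_modulo A11 A12 A21 A22 B1 B2 C1 C2 D t V \<longleftrightarrow>
    subspace V \<and>
    (\<forall>x1 x2 u y x1' x2' u' y'.
      descriptor_solution A11 A12 A21 A22 B1 B2 C1 C2 D x1 x2 u y \<longrightarrow>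
      descriptor_solution A11 A12 A21 A22 B1 B2 C1 C2 D x1' x2' u' y' \<longrightarrow>
      (\<forall>\<tau>\<ge>0. y \<tau> = y' \<tau>) \<longrightarrow> x1 t - x1' t \<in> V)"

definition reconstructible_only_modulo ::
  "real^'n^'n \<Rightarrow> real^'k^'n \<Rightarrow> real^'n^'k \<Rightarrow> real^'k^'k \<Rightarrow> real^'m^'n \<Rightarrow> real^'m^'k \<Rightarrow>
   real^'n^'p \<Rightarrow> real^'k^'p \<Rightarrow> real^'m^'p \<Rightarrow> real \<Rightarrow> (real^'n) set \<Rightarrow> bool"
  where "reconstructible_only_modulo A11 A12 A21 A22 B1 B2 C1 C2 D t V \<longleftrightarrow>
    reconstructible_modulo A11 A12 A21 A22 B1 B2 C1 C2 D t V \<and>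
    (\<forall>W. reconstructible_modulo A11 A12 A21 A22 B1 B2 C1 C2 D t W \<longrightarrow> V \<subseteq> W)"

end

theory Submission
  imports Defs
begin

text \<open>
  The largest output-nulling subspace \<open>V\<close> of the associated system is at every time exactly the
  set of states of those trajectories of the descriptor system whose output is zero. Since the
  trajectories form a linear space, such states are precisely what the output leaves undetermined.

  \<open>V\<close> suffices: by linearity, the difference of two trajectories with the same output is a
  trajectory with output zero, and the algebraic equation \<open>0 = A21 x1 + A22 x2 + B2 u\<close> says
  that it also makes the additional output of the associated system vanish. The subspace spanned
  by all values of its state is closed, so it contains the derivative of the state at every time;
  the equations of the system then say exactly that this span is output-nulling
  (\<open>output_nulling_span_trajectory\<close>). Hence it lies in \<open>V\<close>.

  Nothing smaller suffices: the inputs that keep the state in \<open>V\<close> and the output at zero can be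
  chosen by a linear feedback (\<open>output_nulling_linear_feedback\<close>), under which the state obeys a
  linear differential equation \<open>x' = M x\<close> that leaves \<open>V\<close> invariant. The equation can be solved
  backwards as well as forwards (\<open>linear_flow_exists\<close>), so through every \<open>v \<in> V\<close>, at any
  prescribed time, there passes a smooth trajectory with output zero. The output does not
  distinguish it from the zero trajectory, so \<open>v\<close> has to belong to every subspace modulo which
  the state can be reconstructed.
\<close>

section \<open>Trajectories with zero output\<close>

text \<open>
  A vector orthogonal to the subspace has constant inner product zero with the curve, hence
  also with its derivative; and the subspace is its own double orthogonal complement.
\<close>

lemma vector_derivative_in_subspace:
  fixes x :: "real \<Rightarrow> 'a::euclidean_space"
  assumes S: "subspace S" and x: "\<And>s. s \<ge> 0 \<Longrightarrow> x s \<in> S" and t: "t \<ge> 0"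
    and d: "(x has_vector_derivative d) (at t within {0..})"
  shows "d \<in> S"
proof -
  have "d \<bullet> z = 0" if z: "z \<in> S\<^sup>\<bottom>" for z
  proof (rule vector_derivative_unique_within)
    show "at t within {0..} \<noteq> bot"
    proof -
      have "at_right t \<le> at t within {0..}" using t by (intro at_le) auto
      then show ?thesis using trivial_limit_at_right_real[of t] by (auto simp: bot_unique)
    qed
    show "((\<lambda>s. x s \<bullet> z) has_vector_derivative d \<bullet> z) (at t within {0..})"
      by (rule bounded_linear.has_vector_derivative[OF bounded_linear_inner_left d])
    have "x s \<bullet> z = 0" if "s \<ge> 0" for s
      using x[OF that] z by (auto simp: orthogonal_comp_def orthogonal_def inner_commute)
    then show "((\<lambda>s. x s \<bullet> z) has_vector_derivative 0) (at t within {0..})"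
      using t by (auto intro: has_vector_derivative_transform[of _ _ _ "\<lambda>_. 0"])
  qed
  then have "d \<in> (S\<^sup>\<bottom>)\<^sup>\<bottom>"
    by (auto simp: orthogonal_comp_def orthogonal_def inner_commute)
  then show ?thesis
    by (simp add: orthogonal_comp_self[OF S])
qed

text \<open>
  Along the trajectory, \<open>A (x t) = x' t + B (- w t)\<close> and \<open>C (x t) = D (- w t)\<close>, where the
  derivative \<open>x' t\<close> stays in the span; linear combinations inherit such a representation.
\<close>

lemma output_nulling_span_trajectory:
  fixes x :: "real \<Rightarrow> 'a::euclidean_space" and w :: "real \<Rightarrow> 'w::real_vector"
  assumes lin: "linear A" "linear B" "linear C" "linear D"
    and state: "\<And>t. t \<ge> 0 \<Longrightarrow>
      (x has_vector_derivative A (x t) + B (w t)) (at t within {0..})"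
    and output_zero: "\<And>t. t \<ge> 0 \<Longrightarrow> C (x t) + D (w t) = 0"
  shows "output_nulling A B C D (span (x ` {0..}))"
proof -
  let ?S = "span (x ` {0..})"
  have "\<exists>v\<in>?S. \<exists>w. A z = v + B w \<and> C z = D w" if "z \<in> ?S" for z
    using that
  proof (induction rule: span_induct_alt)
    case base
    show ?case
      using lin by (intro bexI[of _ 0] exI[of _ 0]) (auto simp: linear_0 span_zero)
  next
    case (step c y z)
    then obtain t where t: "t \<ge> 0" "y = x t" by auto
    have 1: "A y + B (w t) \<in> ?S"
      unfolding t(2)
      by (rule vector_derivative_in_subspace[OF subspace_span _ t(1) state[OF t(1)]])
        (auto intro: span_base)
    from step(2) obtain v' w' where 2: "v' \<in> ?S" "A z = v' + B w'" "C z = D w'" by blast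
    have 3: "C y = - D (w t)"
      using output_zero[OF t(1)] t(2) by (simp add: eq_neg_iff_add_eq_0)
    show ?case
    proof (intro bexI exI conjI)
      show "c *\<^sub>R (A y + B (w t)) + v' \<in> ?S" using span_add[OF span_scale[OF 1] 2(1)] .
      show "A (c *\<^sub>R y + z) = (c *\<^sub>R (A y + B (w t)) + v') + B (c *\<^sub>R (- w t) + w')"
        using lin 2 by (simp add: linear_add linear_scale linear_neg linear_diff algebra_simps)
      show "C (c *\<^sub>R y + z) = D (c *\<^sub>R (- w t) + w')"
        using lin 2 3 by (simp add: linear_add linear_scale linear_neg linear_diff)
    qed
  qed
  then show ?thesis unfolding output_nulling_iff by simp
qed

section \<open>Feedback that keeps the output at zero\<close>

text \<open>
  For the elements of a basis of the subspace, next state and input can be chosen freely; the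
  linear extension of these choices works on the whole subspace, because the conditions on
  them are linear.
\<close>

lemma output_nulling_linear_feedback:
  fixes A :: "'x::real_vector \<Rightarrow> 'x" and B :: "'w::real_vector \<Rightarrow> 'x"
    and C :: "'x \<Rightarrow> 'z::real_vector"
  assumes lin: "linear A" "linear B" "linear C" "linear D"
    and V: "output_nulling A B C D V"
  obtains M F where "linear M" "linear F" "\<And>x. x \<in> V \<Longrightarrow> M x \<in> V"
    "\<And>x. x \<in> V \<Longrightarrow> M x = A x + B (F x)" "\<And>x. x \<in> V \<Longrightarrow> C x + D (F x) = 0"
proof -
  have sub: "subspace V" using V by (simp add: output_nulling_iff)
  have "\<forall>x\<in>V. \<exists>w. A x + B w \<in> V \<and> C x + D w = 0"
  proof
    fix x assume "x \<in> V"
    then obtain v w where "v \<in> V" "A x = v + B w" "C x = D w"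
      using V unfolding output_nulling_iff by blast
    then show "\<exists>w. A x + B w \<in> V \<and> C x + D w = 0"
      using lin by (intro exI[of _ "- w"]) (simp add: linear_neg)
  qed
  then obtain f where f: "\<And>x. x \<in> V \<Longrightarrow> A x + B (f x) \<in> V \<and> C x + D (f x) = 0"
    by metis
  obtain b where b: "b \<subseteq> V" "independent b" "span b = V"
    using basis_exists[of V] sub by (metis span_minimal subset_antisym)
  obtain F where F: "linear F" "\<And>x. x \<in> b \<Longrightarrow> F x = f x"
    using linear_independent_extend[OF b(2), of f] by blast
  let ?M = "\<lambda>x. A x + B (F x)"
  have M: "linear ?M"
    using linear_compose_add[OF lin(1) linear_compose[OF F(1) lin(2)]] by (simp add: o_def)
  have "A x + B (F x) \<in> V \<and> C x + D (F x) = 0" if "x \<in> V" for x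
  proof -
    have "x \<in> span b" using that b(3) by simp
    then show ?thesis
    proof (induction rule: span_induct_alt)
      case base
      show ?case
        using lin F(1) sub by (simp add: linear_0 subspace_0)
    next
      case (step c y z)
      have "A y + B (F y) \<in> V" "C y + D (F y) = 0"
        using f[of y] F(2)[of y] step(1) b(1) by auto
      moreover have "A (c *\<^sub>R y + z) + B (F (c *\<^sub>R y + z)) =
          c *\<^sub>R (A y + B (F y)) + (A z + B (F z))"
        "C (c *\<^sub>R y + z) + D (F (c *\<^sub>R y + z)) =
          c *\<^sub>R (C y + D (F y)) + (C z + D (F z))"
        using lin F(1) by (simp_all add: linear_add linear_scale algebra_simps)
      ultimately show ?case
        using step(2) sub by (simp add: subspace_add subspace_scale)
    qed
  qed
  with M F(1) show thesis
    by (intro that[of ?M F]) auto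
qed

section \<open>Linear differential equations\<close>

text \<open>
  The solution is the exponential series applied to the initial value. Its derivative is
  computed for each coordinate, where it is an everywhere convergent real power series. The
  partial sums belong to every invariant subspace that contains the initial value, and so
  does their limit.
\<close>

lemma linear_flow_exists:
  fixes M :: "'a::euclidean_space \<Rightarrow> 'a"
  assumes M: "linear M" and S: "subspace S" "\<And>x. x \<in> S \<Longrightarrow> M x \<in> S" and v: "v \<in> S"
  obtains x where "x t\<^sub>0 = v" "\<And>t. x t \<in> S" "\<And>t. (x has_vector_derivative M (x t)) (at t)"
proof -
  let ?a = "\<lambda>n. (M ^^ n) v /\<^sub>R fact n"
  define e where "e s = (\<Sum>n. s ^ n *\<^sub>R ?a n)" for s :: real
  obtain K where K: "K > 0" "\<And>x. norm (M x) \<le> K * norm x"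
    using linear_bounded_pos[OF M] by blast
  have growth: "norm ((M ^^ n) v) \<le> K ^ n * norm v" for n
  proof (induction n)
    case (Suc n)
    have "norm ((M ^^ Suc n) v) \<le> K * norm ((M ^^ n) v)" using K(2) by simp
    also have "\<dots> \<le> K * (K ^ n * norm v)" using Suc K(1) by simp
    finally show ?case by simp
  qed simp
  have summ: "summable (\<lambda>n. s ^ n *\<^sub>R ?a n)" for s :: real
  proof (rule summable_comparison_test')
    show "summable (\<lambda>n. (\<bar>s\<bar> * K) ^ n /\<^sub>R fact n * norm v)"
      by (intro summable_mult2 sums_summable[OF exp_converges])
    fix n :: nat
    have "\<bar>s\<bar> ^ n * norm ((M ^^ n) v) / fact n \<le> \<bar>s\<bar> ^ n * (K ^ n * norm v) / fact n"
      by (intro divide_right_mono mult_left_mono growth) auto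
    then show "norm (s ^ n *\<^sub>R ?a n) \<le> (\<bar>s\<bar> * K) ^ n /\<^sub>R fact n * norm v"
      by (simp add: power_abs power_mult_distrib field_simps)
  qed
  have M_bl: "bounded_linear M" using M by (simp add: linear_linear)
  have deriv: "(e has_vector_derivative M (e s)) (at s)" for s
  proof -
    have "((\<lambda>s. e s \<bullet> i) has_derivative (\<lambda>h. (h *\<^sub>R M (e s)) \<bullet> i)) (at s)" for i
    proof -
      let ?c = "\<lambda>n. ?a n \<bullet> i"
      have e_i: "e s \<bullet> i = (\<Sum>n. ?c n * s ^ n)" for s
        unfolding e_def bounded_linear.suminf[OF bounded_linear_inner_left summ]
        by (simp add: mult_ac)
      have sum_c: "summable (\<lambda>n. ?c n * s ^ n)" for s
        using bounded_linear.summable[OF bounded_linear_inner_left summ[of s], of i]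
        by (simp add: mult_ac)
      have Ma: "M (?a n) = real (Suc n) *\<^sub>R ?a (Suc n)" for n
      proof -
        have "real (Suc n) * inverse (fact (Suc n)) = inverse (fact n)"
          by (simp add: fact_Suc del: of_nat_Suc)
        then show ?thesis by (simp only: linear_scale[OF M] scaleR_scaleR funpow.simps o_apply)
      qed
      have term_eq: "M (s ^ n *\<^sub>R ?a n) \<bullet> i = diffs ?c n * s ^ n" for n
        unfolding linear_scale[OF M, of "s ^ n"] Ma diffs_def inner_scaleR_left by (rule mult.commute)
      have "M (e s) \<bullet> i = (\<Sum>n. M (s ^ n *\<^sub>R ?a n) \<bullet> i)"
        unfolding e_def bounded_linear.suminf[OF M_bl summ]
        by (rule bounded_linear.suminf[OF bounded_linear_inner_left
              bounded_linear.summable[OF M_bl summ]])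
      also have "\<dots> = (\<Sum>n. diffs ?c n * s ^ n)"
        by (simp only: term_eq)
      finally have "((\<lambda>s. e s \<bullet> i) has_field_derivative M (e s) \<bullet> i) (at s)"
        unfolding e_i using termdiffs_strong_converges_everywhere[OF sum_c] by simp
      then show ?thesis
        by (simp add: has_field_derivative_def mult.commute[of _ "M (e s) \<bullet> i"])
    qed
    then show ?thesis
      unfolding has_vector_derivative_def
      by (subst has_derivative_componentwise_within) blast
  qed
  have inv: "e s \<in> S" for s
  proof (rule closed_sequentially[OF closed_subspace[OF S(1)]])
    have "(M ^^ n) v \<in> S" for n by (induction n) (use v S(2) in auto)
    then show "(\<Sum>n<k. s ^ n *\<^sub>R ?a n) \<in> S" for k
      using S(1) by (intro subspace_sum subspace_scale) auto
    show "(\<lambda>k. \<Sum>n<k. s ^ n *\<^sub>R ?a n) \<longlonglongrightarrow> e s"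
      unfolding e_def by (rule summable_LIMSEQ[OF summ])
  qed
  have "e 0 = v"
    unfolding e_def by (subst suminf_finite[of "{0}"]) auto
  moreover have "((\<lambda>t. e (t - t\<^sub>0)) has_vector_derivative M (e (t - t\<^sub>0))) (at t)" for t
  proof -
    have "((\<lambda>t. t - t\<^sub>0) has_vector_derivative 1) (at t)"
      by (auto intro!: derivative_eq_intros)
    from vector_diff_chain_at[OF this deriv] show ?thesis by (simp add: o_def)
  qed
  ultimately show thesis
    using inv by (intro that[of "\<lambda>t. e (t - t\<^sub>0)"]) auto
qed

text \<open>The \<open>k\<close>-th derivative along the flow is obtained by applying \<open>M\<close> to the state \<open>k\<close> times.\<close>

lemma smooth_signal_linear_flow:
  fixes x :: "real \<Rightarrow> 'a::euclidean_space" and G :: "'a \<Rightarrow> 'b::real_normed_vector"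
  assumes M: "linear M" and G: "linear G"
    and x: "\<And>t. (x has_vector_derivative M (x t)) (at t)"
  shows "smooth_signal (\<lambda>t. G (x t))"
  unfolding smooth_signal_def
proof (intro exI[of _ "\<lambda>k t. G ((M ^^ k) (x t))"] conjI allI impI)
  show "(\<lambda>t. G ((M ^^ 0) (x t))) = (\<lambda>t. G (x t))" by simp
next
  fix k and t :: real
  have "linear (M ^^ k)"
  proof (induction k)
    case 0
    show ?case using linear_id by (simp add: id_def)
  next
    case (Suc k)
    show ?case unfolding funpow.simps by (rule linear_compose[OF Suc M])
  qed
  then have "bounded_linear (\<lambda>z. G ((M ^^ k) z))"
    using linear_compose[OF _ G] by (simp add: linear_linear o_def)
  from bounded_linear.has_vector_derivative[OF this x]
  show "((\<lambda>t. G ((M ^^ k) (x t))) has_vector_derivative G ((M ^^ Suc k) (x t)))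
      (at t within {0..})"
    by (simp add: has_vector_derivative_at_within funpow_swap1)
qed

section \<open>Reconstruction of the state of a descriptor system\<close>

lemma smooth_signal_diff:
  assumes "smooth_signal f" "smooth_signal g"
  shows "smooth_signal (\<lambda>t. f t - g t)"
proof -
  obtain F G where "F 0 = f" "G 0 = g"
    "\<And>k t. t \<ge> 0 \<Longrightarrow> (F k has_vector_derivative F (Suc k) t) (at t within {0..})"
    "\<And>k t. t \<ge> 0 \<Longrightarrow> (G k has_vector_derivative G (Suc k) t) (at t within {0..})"
    using assms unfolding smooth_signal_def by metis
  then show ?thesis
    unfolding smooth_signal_def
    by (intro exI[of _ "\<lambda>k t. F k t - G k t"]) (auto intro!: has_vector_derivative_diff)
qed

lemma descriptor_solution_diff:
  assumes "descriptor_solution A11 A12 A21 A22 B1 B2 C1 C2 D x1 x2 u y"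
    and "descriptor_solution A11 A12 A21 A22 B1 B2 C1 C2 D x1' x2' u' y'"
  shows "descriptor_solution A11 A12 A21 A22 B1 B2 C1 C2 D (\<lambda>t. x1 t - x1' t)
    (\<lambda>t. x2 t - x2' t) (\<lambda>t. u t - u' t) (\<lambda>t. y t - y' t)"
  unfolding descriptor_solution_def
proof (intro conjI allI impI)
  show "smooth_signal (\<lambda>t. u t - u' t)"
    using assms by (simp add: descriptor_solution_def smooth_signal_diff)
next
  fix t :: real assume t: "t \<ge> 0"
  note s = assms[unfolded descriptor_solution_def, THEN conjunct2, rule_format, OF t]
  show "((\<lambda>t. x1 t - x1' t) has_vector_derivative
      A11 *v (x1 t - x1' t) + A12 *v (x2 t - x2' t) + B1 *v (u t - u' t)) (at t within {0..})"
    using has_vector_derivative_diff[OF s(1)[THEN conjunct1] s(2)[THEN conjunct1]]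
    by (simp add: matrix_vector_mult_diff_distrib algebra_simps)
  have "0 - 0 = (A21 *v x1 t + A22 *v x2 t + B2 *v u t) -
      (A21 *v x1' t + A22 *v x2' t + B2 *v u' t)"
    using s by metis
  then show "0 = A21 *v (x1 t - x1' t) + A22 *v (x2 t - x2' t) + B2 *v (u t - u' t)"
    by (simp add: matrix_vector_mult_diff_distrib algebra_simps)
  show "y t - y' t = C1 *v (x1 t - x1' t) + C2 *v (x2 t - x2' t) + D *v (u t - u' t)"
    using s by (simp add: matrix_vector_mult_diff_distrib algebra_simps)
qed

lemma linear_associated_system:
  "linear (\<lambda>x1. A11 *v x1)"
  "linear (\<lambda>(x2, u). A12 *v x2 + B1 *v u)"
  "linear (\<lambda>x1. (A21 *v x1, C1 *v x1))"
  "linear (\<lambda>(x2, u). (A22 *v x2 + B2 *v u, C2 *v x2 + D *v u))"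
  for A11 :: "real^'n^'n" and A12 :: "real^'k^'n" and A21 :: "real^'n^'k" and A22 :: "real^'k^'k"
    and B1 :: "real^'m^'n" and B2 :: "real^'m^'k"
    and C1 :: "real^'n^'p" and C2 :: "real^'k^'p" and D :: "real^'m^'p"
  by (auto intro!: linearI simp: algebra_simps matrix_vector_right_distrib scaleR_right_distrib
      matrix_vector_mult_scaleR)

text \<open>
  With \<open>x2\<close> regarded as an input, a trajectory of the descriptor system with output zero is a
  trajectory of the associated system with output zero.
\<close>

lemma zero_output_state_in_V1_star:
  fixes A11 :: "real^'n^'n"
  assumes sol: "descriptor_solution A11 A12 A21 A22 B1 B2 C1 C2 D x1 x2 u y"
    and y: "\<And>\<tau>. \<tau> \<ge> 0 \<Longrightarrow> y \<tau> = 0" and t: "t \<ge> 0"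
  shows "x1 t \<in> V1_star A11 A12 A21 A22 B1 B2 C1 C2 D"
proof -
  note s = sol[unfolded descriptor_solution_def, THEN conjunct2, rule_format]
  have "span (x1 ` {0..}) \<subseteq> V1_star A11 A12 A21 A22 B1 B2 C1 C2 D"
    unfolding V1_star_def
  proof (intro output_nulling_le_largest linear_associated_system
      output_nulling_span_trajectory[where w = "\<lambda>t. (x2 t, u t)"])
    fix \<tau> :: real assume "\<tau> \<ge> 0"
    from s[OF this] y[OF this]
    show "(x1 has_vector_derivative A11 *v x1 \<tau> +
        (case (x2 \<tau>, u \<tau>) of (x2, u) \<Rightarrow> A12 *v x2 + B1 *v u)) (at \<tau> within {0..})"
      and "(A21 *v x1 \<tau>, C1 *v x1 \<tau>) +
        (case (x2 \<tau>, u \<tau>) of (x2, u) \<Rightarrow> (A22 *v x2 + B2 *v u, C2 *v x2 + D *v u)) = 0"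
      by (auto simp: add.assoc zero_prod_def)
  qed
  then show ?thesis using t by (auto intro: span_base)
qed

text \<open>
  A linear feedback \<open>(x2, u) = F x1\<close> turns the associated system into a linear differential
  equation on the subspace. The input \<open>u\<close> is smooth, being a linear image of its solution, and
  the output equations of the associated system include the algebraic equation of the
  descriptor system.
\<close>

lemma zero_output_solution_through_V1_star:
  fixes A11 :: "real^'n^'n"
  assumes v: "v \<in> V1_star A11 A12 A21 A22 B1 B2 C1 C2 D"
  obtains x1 x2 u where "descriptor_solution A11 A12 A21 A22 B1 B2 C1 C2 D x1 x2 u (\<lambda>_. 0)"
    and "x1 t = v"
proof -
  let ?V = "V1_star A11 A12 A21 A22 B1 B2 C1 C2 D"
  note largest = output_nulling_largest[OF linear_associated_system, folded V1_star_def,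
      of A11 A12 B1 A21 C1 A22 B2 C2 D]
  obtain M F where M: "linear M" and F: "linear F" and inv: "\<And>x. x \<in> ?V \<Longrightarrow> M x \<in> ?V"
    and M_eq: "\<And>x. x \<in> ?V \<Longrightarrow> M x = A11 *v x + (case F x of (x2, u) \<Rightarrow> A12 *v x2 + B1 *v u)"
    and out: "\<And>x. x \<in> ?V \<Longrightarrow> (A21 *v x, C1 *v x) +
        (case F x of (x2, u) \<Rightarrow> (A22 *v x2 + B2 *v u, C2 *v x2 + D *v u)) = 0"
    by (rule output_nulling_linear_feedback[OF linear_associated_system largest], rule that) blast+
  have "subspace ?V" using largest by (simp add: output_nulling_def)
  then obtain x where x: "x t = v" "\<And>s. x s \<in> ?V" "\<And>s. (x has_vector_derivative M (x s)) (at s)"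
    using linear_flow_exists[OF M _ inv v] by blast
  have "linear (\<lambda>z. snd (F z))"
    using linear_compose[OF F linear_snd] by (simp add: o_def)
  from smooth_signal_linear_flow[OF M this x(3)] have "smooth_signal (\<lambda>s. snd (F (x s)))" .
  moreover have "(x has_vector_derivative
      A11 *v x s + A12 *v fst (F (x s)) + B1 *v snd (F (x s))) (at s within {0..})" for s
    using has_vector_derivative_at_within[OF x(3)[of s]] M_eq[OF x(2)[of s]]
    by (simp add: case_prod_beta add.assoc)
  ultimately have "descriptor_solution A11 A12 A21 A22 B1 B2 C1 C2 D x
      (\<lambda>s. fst (F (x s))) (\<lambda>s. snd (F (x s))) (\<lambda>_. 0)"
    using out[OF x(2)]
    by (simp add: descriptor_solution_def case_prod_beta zero_prod_def add.assoc)
  with x(1) show thesis by (intro that)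
qed

theorem lemma6p1:
  fixes A11 :: "real^'n^'n" and A12 :: "real^'k^'n" and A21 :: "real^'n^'k" and A22 :: "real^'k^'k"
    and B1 :: "real^'m^'n" and B2 :: "real^'m^'k"
    and C1 :: "real^'n^'p" and C2 :: "real^'k^'p" and D :: "real^'m^'p"
    and t :: real
  assumes "regular_pair (block_matrix (mat 1) 0 0 0) (block_matrix A11 A12 A21 A22)"
    and "t \<ge> 0"
  shows "reconstructible_only_modulo A11 A12 A21 A22 B1 B2 C1 C2 D t
           (V1_star A11 A12 A21 A22 B1 B2 C1 C2 D)"
proof -
  let ?sol = "descriptor_solution A11 A12 A21 A22 B1 B2 C1 C2 D"
  let ?V = "V1_star A11 A12 A21 A22 B1 B2 C1 C2 D"
  have "subspace ?V"
    using output_nulling_largest[OF linear_associated_system, of A11 A12 B1 A21 C1 A22 B2 C2 D]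
    by (simp add: V1_star_def output_nulling_def)
  moreover have "x1 t - x1' t \<in> ?V"
    if "?sol x1 x2 u y" "?sol x1' x2' u' y'" "\<forall>\<tau>\<ge>0. y \<tau> = y' \<tau>" for x1 x2 u y x1' x2' u' y'
    using zero_output_state_in_V1_star[OF descriptor_solution_diff[OF that(1,2)]] that(3) assms(2)
    by simp
  moreover have "?V \<subseteq> W"
    if W: "reconstructible_modulo A11 A12 A21 A22 B1 B2 C1 C2 D t W" for W
  proof
    fix v assume "v \<in> ?V"
    then obtain x1 x2 u where x: "?sol x1 x2 u (\<lambda>_. 0)" "x1 t = v"
      by (rule zero_output_solution_through_V1_star)
    have "?sol (\<lambda>_. 0) (\<lambda>_. 0) (\<lambda>_. 0) (\<lambda>_. 0)"
      using descriptor_solution_diff[OF x(1) x(1)] by simp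
    with W x(1) have "x1 t - 0 \<in> W"
      unfolding reconstructible_modulo_def by blast
    with x(2) show "v \<in> W" by simp
  qed
  ultimately show ?thesis
    unfolding reconstructible_only_modulo_def reconstructible_modulo_def by blast
qed

end
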